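(* Let $x$ be a bordered word of length $n \geq 1$ and let $e = \operatorname{ice}(x)$. Then $$\operatorname{nnp}(x) \leq \frac{e}{2} + 1 + \frac{\ln(n/2)}{\ln\bigl(e/(e-1)\bigr)}.$$
   Context: Let $x$ be a finite nonempty word of length $n$. An integer $p$ with $1 \le p \le n$ is a period of $x$ if $x[i]=x[i+p]$ for all $1 \le i \le n-p$. A period is nontrivial if $p<n$. $\operatorname{nnp}(x)$ denotes the number of nontrivial periods of $x$, and $\operatorname{per}(x)$ denotes the least period of $x$. The exponent of $x$ is $\exp(x) = |x|/\operatorname{per}(x)$. The initial critical exponent of $x$ is $\operatorname{ice}(x) = \sup\{\exp(w) : w \text{ a nonempty prefix of } x\}$. A border of $x$ is a word $w$ with $0<|w|<|x|$ that is both a prefix and a suffix of $x$ (overlapping allowed); $x$ is bordered if it has at least one border. *)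

theory Defs
  imports Complex_Main "HOL-Library.Sublist"
begin

text \<open>
  Finite words over an arbitrary alphabet are lists. Letters are indexed from 0 here,
  so the \<open>i\<close>-th letter in the usual 1-based indexing is \<open>x ! (i - 1)\<close>.
\<close>

definition is_period :: "'a list \<Rightarrow> nat \<Rightarrow> bool" where
  "is_period x p \<longleftrightarrow>
     1 \<le> p \<and> p \<le> length x \<and> (\<forall>i. i + p < length x \<longrightarrow> x ! i = x ! (i + p))"

definition nnp :: "'a list \<Rightarrow> nat" where
  "nnp x = card {p. is_period x p \<and> p < length x}"

definition per :: "'a list \<Rightarrow> nat" where
  "per x = (LEAST p. is_period x p)"

definition exponent :: "'a list \<Rightarrow> real" where
  "exponent x = real (length x) / real (per x)"

definition ice :: "'a list \<Rightarrow> real" where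
  "ice x = Sup {exponent w | w. prefix w x \<and> w \<noteq> []}"

definition is_border :: "'a list \<Rightarrow> 'a list \<Rightarrow> bool" where
  "is_border w x \<longleftrightarrow> 0 < length w \<and> length w < length x \<and> prefix w x \<and> suffix w x"

definition bordered :: "'a list \<Rightarrow> bool" where
  "bordered x \<longleftrightarrow> (\<exists>w. is_border w x)"

end

theory Submission
  imports Defs
begin

text \<open>
  Split the nontrivial periods of a word of length \<open>n\<close> at \<open>n/2\<close>. By the weak form of the Fine--Wilf
  theorem, every period \<open>\<le> n/2\<close> is a multiple of the least one, so there are at most \<open>e/2\<close> of
  them. A period \<open>p > n/2\<close> corresponds to a border of length \<open>n - p < n/2\<close>. If \<open>v\<close> is a border
  shorter than the border \<open>w\<close>, then \<open>v\<close> is a border of \<open>w\<close>, so the prefix \<open>w\<close> has period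
  \<open>|w| - |v|\<close> and \<open>|w| \<le> e (|w| - |v|)\<close>. Hence the border lengths grow at least geometrically with
  ratio \<open>e / (e - 1)\<close>.
\<close>

section \<open>Lacunary sets\<close>

definition lacunary :: "'a::linordered_idom \<Rightarrow> 'a set \<Rightarrow> bool" where
  "lacunary r B \<longleftrightarrow> (\<forall>b\<in>B. \<forall>c\<in>B. b < c \<longrightarrow> r * b \<le> c)"

lemma lacunary_power_mult_Min_le_Max:
  fixes r :: "'a::linordered_idom"
  assumes "finite B" "B \<noteq> {}" "0 \<le> r" "lacunary r B"
  shows "r ^ (card B - 1) * Min B \<le> Max B"
  using assms
proof (induction B rule: finite_linorder_max_induct)
  case (insert c A)
  show ?case
  proof (cases "A = {}")
    case False
    have Max_less: "Max A < c" and Min_less: "Min A < c"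
      using insert.hyps False by simp_all
    have "card (insert c A) - 1 = Suc (card A - 1)"
      using insert.hyps False by (auto simp: card_insert_if card_gt_0_iff)
    moreover have "Min (insert c A) = Min A" "Max (insert c A) = c"
      using insert.hyps(1) False Max_less Min_less by simp_all
    ultimately have "r ^ (card (insert c A) - 1) * Min (insert c A)
        = r * (r ^ (card A - 1) * Min A)"
      by (simp add: mult.assoc)
    also have "\<dots> \<le> r * Max A"
      using insert.IH insert.prems False by (intro mult_left_mono) (auto simp: lacunary_def)
    also have "\<dots> \<le> c"
      using insert.prems(3) Max_less Max_in[OF insert.hyps(1) False] by (simp add: lacunary_def)
    finally show ?thesis using \<open>Max (insert c A) = c\<close> by simp
  qed simp
qed simp

lemma card_lacunary_le:
  fixes r :: real
  assumes "lacunary r B" "1 < r" "B \<subseteq> {a..b}" "0 < a" "a \<le> b"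
  shows "real (card B) \<le> 1 + log r (b / a)"
proof (cases "finite B \<and> B \<noteq> {}")
  case True
  then have "Min B \<in> {a..b}" "Max B \<in> {a..b}"
    using assms(3) Min_in Max_in by blast+
  then have "r ^ (card B - 1) * a \<le> r ^ (card B - 1) * Min B"
    using \<open>1 < r\<close> by simp
  also have "\<dots> \<le> Max B"
    using lacunary_power_mult_Min_le_Max[of B r] True assms(1,2) by simp
  also have "\<dots> \<le> b"
    using \<open>Max B \<in> {a..b}\<close> by simp
  finally have "r ^ (card B - 1) \<le> b / a"
    using \<open>0 < a\<close> by (simp add: pos_le_divide_eq)
  then show ?thesis
    using le_log_of_power[of r "card B - 1"] \<open>1 < r\<close> by fastforce
next
  case False
  then have "card B = 0" by auto
  then show ?thesis using assms by simp
qed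

section \<open>Periods and borders\<close>

lemma is_period_iff_is_border_drop:
  assumes "0 < p" "p < length x"
  shows "is_period x p \<longleftrightarrow> is_border (drop p x) x"
proof -
  have "prefix (drop p x) x \<longleftrightarrow> drop p x = take (length x - p) x"
    by (metis append_eq_conv_conj length_drop prefix_def take_is_prefix)
  also have "\<dots> \<longleftrightarrow> (\<forall>i. i + p < length x \<longrightarrow> x ! i = x ! (i + p))"
    by (auto simp: list_eq_iff_nth_eq less_diff_conv add.commute)
  finally show ?thesis
    using assms by (auto simp: is_period_def is_border_def suffix_drop)
qed

lemma is_period_if_is_border:
  assumes "is_border w x"
  shows "is_period x (length x - length w)"
proof -
  have "drop (length x - length w) x = w"
    using assms by (auto simp: is_border_def elim: suffixE)
  then show ?thesis
    using assms is_period_iff_is_border_drop[of "length x - length w" x]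
    by (cases x) (auto simp: is_border_def)
qed

lemma is_border_if_shorter:
  assumes "is_border v x" "is_border w x" "length v < length w"
  shows "is_border v w"
  using assms prefix_length_prefix[of v x w] suffix_length_suffix[of v x w]
  by (simp add: is_border_def)

lemma is_period_diff:
  assumes p: "is_period x p" and q: "is_period x q" and "p < q" "p + q \<le> length x"
  shows "is_period x (q - p)"
proof -
  have pos: "0 < p" using p by (simp add: is_period_def)
  have "is_border (drop p x) x" "is_border (drop q x) x"
    using p q pos assms(3,4) by (simp_all flip: is_period_iff_is_border_drop)
  then have "is_border (drop q x) (drop p x)"
    using is_border_if_shorter[of "drop q x" x "drop p x"] assms(3,4) pos by simp
  then have "is_period (drop p x) (q - p)"
    using assms(3,4) by (auto dest: is_period_if_is_border)
  then have tail: "x ! (p + i) = x ! (p + i + (q - p))" if "p + i + (q - p) < length x" for i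
    using that by (auto simp: is_period_def add.assoc)
  have "x ! i = x ! (i + (q - p))" if i: "i + (q - p) < length x" for i
  proof (cases "p \<le> i")
    case True
    then show ?thesis using tail[of "i - p"] i by simp
  next
    case False
    then have "i + q < length x" using assms(4) by simp
    then have "x ! i = x ! (p + i)" "x ! (i + (q - p)) = x ! (p + i + (q - p))"
      using p \<open>p < q\<close> by (auto simp: is_period_def add.commute add.left_commute)
    moreover have "x ! (p + i) = x ! (p + i + (q - p))"
      using tail[of i] \<open>i + q < length x\<close> \<open>p < q\<close> by simp
    ultimately show ?thesis by simp
  qed
  then show ?thesis using assms by (auto simp: is_period_def)
qed

lemma Fine_Wilf_weak:
  assumes "is_period x p" "is_period x q" "p + q \<le> length x"
  shows "is_period x (gcd p q)"
  using assms
proof (induction "p + q" arbitrary: p q rule: less_induct)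
  case (less p q)
  have pos: "0 < p" "0 < q" using less.prems by (auto simp: is_period_def)
  consider (eq) "p = q" | (p_less_q) "p < q" | (q_less_p) "q < p" by linarith
  then show ?case
  proof cases
    case eq
    then show ?thesis using less.prems by simp
  next
    case p_less_q
    then have "is_period x (gcd (q - p) p)"
      using less.hyps[of "q - p" p] less.prems pos is_period_diff[of x p q] by simp
    then show ?thesis using \<open>p < q\<close> by (simp add: gcd_diff1_nat gcd.commute[of p q])
  next
    case q_less_p
    then have "is_period x (gcd (p - q) q)"
      using less.hyps[of "p - q" q] less.prems pos is_period_diff[of x q p] by simp
    then show ?thesis using \<open>q < p\<close> by (simp add: gcd_diff1_nat)
  qed
qed

section \<open>The least period and the initial critical exponent\<close>

lemma is_period_per: "x \<noteq> [] \<Longrightarrow> is_period x (per x)"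
  unfolding per_def by (rule LeastI[of _ "length x"]) (auto simp: is_period_def Suc_le_eq)

lemma per_le: "is_period x p \<Longrightarrow> per x \<le> p"
  unfolding per_def by (rule Least_le)

lemma per_pos: "x \<noteq> [] \<Longrightarrow> 0 < per x"
  using is_period_per[of x] by (simp add: is_period_def)

lemma per_dvd_period:
  assumes "is_period x q" "per x + q \<le> length x"
  shows "per x dvd q"
proof -
  have "x \<noteq> []" using assms(1) by (auto simp: is_period_def)
  then have "per x \<le> gcd (per x) q"
    using Fine_Wilf_weak[OF is_period_per assms] by (intro per_le)
  then have "gcd (per x) q = per x"
    using per_pos[OF \<open>x \<noteq> []\<close>] by (intro antisym gcd_le1_nat) auto
  then show ?thesis by (metis gcd_dvd2)
qed

lemma exponent_le_length:
  assumes "x \<noteq> []"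
  shows "exponent x \<le> length x"
  using per_pos[OF assms] mult_left_mono[of 1 "real (per x)" "real (length x)"]
  by (simp add: exponent_def divide_le_eq)

lemma exponent_prefix_le_ice:
  assumes "prefix w x" "w \<noteq> []"
  shows "exponent w \<le> ice x"
  unfolding ice_def
proof (rule cSup_upper)
  have "exponent v \<le> length x" if "prefix v x" "v \<noteq> []" for v
    using exponent_le_length[OF that(2)] prefix_length_le[OF that(1)] by linarith
  then show "bdd_above {exponent w |w. prefix w x \<and> w \<noteq> []}"
    by (intro bdd_aboveI[of _ "real (length x)"]) blast
qed (use assms in blast)

lemma length_prefix_le_ice_mult_period:
  assumes "prefix w x" "is_period w p"
  shows "length w \<le> ice x * p"
proof -
  have "w \<noteq> []" using assms(2) by (auto simp: is_period_def)
  then have "real (length w) = exponent w * per w"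
    using per_pos[of w] by (simp add: exponent_def)
  also have "\<dots> \<le> exponent w * p"
    using per_le[OF assms(2)] by (intro mult_left_mono) (simp_all add: exponent_def)
  also have "\<dots> \<le> ice x * p"
    using exponent_prefix_le_ice[OF assms(1) \<open>w \<noteq> []\<close>] by (intro mult_right_mono) simp_all
  finally show ?thesis .
qed

lemma length_prefix_le_ice_mult_border_diff:
  assumes "prefix w x" "is_border v w"
  shows "length w \<le> ice x * (real (length w) - real (length v))"
  using length_prefix_le_ice_mult_period[OF assms(1) is_period_if_is_border[OF assms(2)]] assms(2)
  by (simp add: is_border_def of_nat_diff)

lemma bordered_ice_gt_1:
  assumes "bordered x"
  shows "1 < ice x"
proof (rule ccontr)
  assume "\<not> 1 < ice x"
  obtain w where w: "is_border w x" using assms by (auto simp: bordered_def)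
  have "length x \<le> ice x * (real (length x) - real (length w))"
    using length_prefix_le_ice_mult_border_diff[of x x w] w by simp
  also have "\<dots> \<le> 1 * (real (length x) - real (length w))"
    using w \<open>\<not> 1 < ice x\<close> by (intro mult_right_mono) (auto simp: is_border_def)
  finally show False using w by (simp add: is_border_def)
qed

section \<open>Counting periods\<close>

lemma card_periods_le_div_per:
  assumes "2 * m \<le> length x"
  shows "card {p. is_period x p \<and> p \<le> m} \<le> m div per x"
proof -
  have "{p. is_period x p \<and> p \<le> m} \<subseteq> (*) (per x) ` {1..m div per x}"
  proof
    fix q assume "q \<in> {p. is_period x p \<and> p \<le> m}"
    then have q: "is_period x q" "0 < q" "q \<le> m" by (auto simp: is_period_def)
    then have "per x dvd q"
      using per_le[OF q(1)] assms by (intro per_dvd_period) auto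
    then obtain k where k: "q = per x * k" ..
    then have "1 \<le> k" "k \<le> m div per x"
      using q by (auto simp: less_eq_div_iff_mult_less_eq mult.commute Suc_le_eq)
    then show "q \<in> (*) (per x) ` {1..m div per x}" using k by auto
  qed
  from surj_card_le[OF _ this] show ?thesis by simp
qed

lemma card_short_periods_le:
  "card {p. is_period x p \<and> p \<le> length x div 2} \<le> exponent x / 2"
proof -
  have "card {p. is_period x p \<and> p \<le> length x div 2} \<le> length x div 2 div per x"
    by (rule card_periods_le_div_per) simp
  also have "\<dots> = length x div (2 * per x)"
    by (rule div_mult2_eq[symmetric])
  finally have "real (card {p. is_period x p \<and> p \<le> length x div 2}) \<le> length x div (2 * per x)"
    by simp
  also have "\<dots> \<le> real (length x) / real (2 * per x)"
    by (rule of_nat_div_le_of_nat)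
  finally show ?thesis by (simp add: exponent_def mult.commute)
qed

lemma lacunary_border_lengths:
  assumes "1 < ice x"
  shows "lacunary (ice x / (ice x - 1)) {real (length w) | w. is_border w x}"
proof -
  have "ice x / (ice x - 1) * length v \<le> length w"
    if "is_border v x" "is_border w x" "length v < length w" for v w
  proof -
    have "prefix w x" using that(2) by (simp add: is_border_def)
    then have "length w \<le> ice x * (real (length w) - real (length v))"
      using is_border_if_shorter[OF that] by (rule length_prefix_le_ice_mult_border_diff)
    then show ?thesis using assms by (simp add: field_simps)
  qed
  then show ?thesis by (auto simp: lacunary_def)
qed

lemma card_long_periods_le:
  fixes L :: real
  assumes "1 < ice x" "1 \<le> L"
  shows "card {p. is_period x p \<and> p < length x \<and> real (length x - p) \<le> L}
    \<le> 1 + log (ice x / (ice x - 1)) L"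
proof -
  let ?P = "{p. is_period x p \<and> p < length x \<and> real (length x - p) \<le> L}"
  let ?B = "(\<lambda>p. real (length x - p)) ` ?P"
  have "?B \<subseteq> {real (length w) | w. is_border w x}"
  proof
    fix b assume "b \<in> ?B"
    then obtain p where p: "b = length (drop p x)" "is_period x p" "0 < p" "p < length x"
      by (auto simp: is_period_def)
    then show "b \<in> {real (length w) | w. is_border w x}"
      using is_period_iff_is_border_drop by blast
  qed
  then have "lacunary (ice x / (ice x - 1)) ?B"
    using lacunary_border_lengths[OF assms(1)] unfolding lacunary_def by blast
  moreover have "?B \<subseteq> {1..L}" by auto
  ultimately have "card ?B \<le> 1 + log (ice x / (ice x - 1)) (L / 1)"
    using assms by (intro card_lacunary_le) auto
  moreover have "card ?B = card ?P" by (intro card_image) (auto simp: inj_on_def)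
  ultimately show ?thesis by simp
qed

theorem theorem1:
  fixes x :: "'a list" and n :: nat and e :: real
  assumes "length x = n" and "n \<ge> 1" and "bordered x" and "e = ice x"
  shows "real (nnp x) \<le> e / 2 + 1 + ln (real n / 2) / ln (e / (e - 1))"
proof -
  let ?S = "{p. is_period x p \<and> p \<le> n div 2}"
  let ?L = "{p. is_period x p \<and> p < n \<and> real (n - p) \<le> real n / 2}"
  have "2 \<le> n" using assms(1,3) unfolding bordered_def is_border_def by linarith
  have "{p. is_period x p \<and> p < n} = ?S \<union> ?L"
    using \<open>2 \<le> n\<close> by auto
  then have "nnp x \<le> card ?S + card ?L"
    using card_Un_le[of ?S ?L] by (simp add: nnp_def assms(1))
  moreover have "real (card ?S) \<le> e / 2"
    using card_short_periods_le[of x] exponent_prefix_le_ice[of x x] assms by fastforce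
  moreover have "real (card ?L) \<le> 1 + log (e / (e - 1)) (real n / 2)"
    using card_long_periods_le[OF bordered_ice_gt_1, of x "real n / 2"] assms \<open>2 \<le> n\<close> by simp
  ultimately show ?thesis by (simp add: log_def)
qed

end
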